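(* Let $S$ be a finite set (possibly empty). Then the number of families $\mathcal{B}\subseteq\mathcal{P}(S)$ that are bases for a topology on $S$ is $$\big|\{\mathcal{B}\subseteq\mathcal{P}(S) : \mathcal{B}\text{ is a topological basis on }S\}\big| \;=\; \sum_{\mathcal{T}\in\operatorname{Top}(S)} 2^{|\mathcal{T}|-|\mathcal{M}_{\mathcal{T}}|},$$ where $\operatorname{Top}(S)$ is the set of all topologies on $S$ and $\mathcal{M}_{\mathcal{T}}=\{U_x : x\in S\}$ is the set of minimal open neighborhoods of the points of $S$ with respect to $\mathcal{T}$.
   Context: A family $\mathcal{B}\subseteq\mathcal{P}(S)$ is a (topological) basis on $S$ if (1) $\bigcup_{B\in\mathcal{B}}B=S$, and (2) for all $B_1,B_2\in\mathcal{B}$ and all $x\in B_1\cap B_2$ there is $B_3\in\mathcal{B}$ with $x\in B_3\subseteq B_1\cap B_2$. The empty set is allowed, but not required, to be a member of $\mathcal{B}$. A topology $\mathcal{T}$ on $S$ is identified with its family of open sets, and $|\mathcal{T}|$ is the number of open sets (including $\emptyset$). For $x\in S$, $U_x=\bigcap\{U\in\mathcal{T} : x\in U\}$, and $\mathcal{M}_{\mathcal{T}}=\{U_x : x\in S\}$ is taken as a set, so coinciding $U_x$ are counted once. *)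

theory Defs
  imports "HOL-Analysis.Analysis"
begin

text \<open>
  The library's \<^const>\<open>topological_basis\<close> concerns the type-class topology of a whole type; here a
  basis is a family of subsets of a carrier set, with no topology given in advance.
\<close>

definition topological_basis_on :: "'a set \<Rightarrow> 'a set set \<Rightarrow> bool" where
  "topological_basis_on S \<B> \<longleftrightarrow>
     \<B> \<subseteq> Pow S \<and>
     \<Union>\<B> = S \<and>
     (\<forall>B1\<in>\<B>. \<forall>B2\<in>\<B>. \<forall>x\<in>B1 \<inter> B2. \<exists>B3\<in>\<B>. x \<in> B3 \<and> B3 \<subseteq> B1 \<inter> B2)"

definition topologies_on :: "'a set \<Rightarrow> 'a topology set" where
  "topologies_on S = {T. topspace T = S}"

definition opens :: "'a topology \<Rightarrow> 'a set set" where
  "opens T = {U. openin T U}"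

text \<open>
  Only meaningful for points of \<^term>\<open>topspace T\<close>: elsewhere the intersection is over the empty
  family and gives \<^term>\<open>UNIV\<close>.
\<close>

definition min_nbhd :: "'a topology \<Rightarrow> 'a \<Rightarrow> 'a set" where
  "min_nbhd T x = \<Inter>{U \<in> opens T. x \<in> U}"

definition min_nbhds :: "'a topology \<Rightarrow> 'a set set" where
  "min_nbhds T = min_nbhd T ` topspace T"

end

theory Submission
  imports Defs
begin

text \<open>
  In a finite topological space each \<open>U\<^sub>x\<close> is open, hence lies in every basis, and conversely any
  family of open sets containing all the \<open>U\<^sub>x\<close> is a basis. So the bases of a topology \<open>T\<close> form the
  interval between \<open>min_nbhds T\<close> and \<open>opens T\<close> in the lattice of families of sets, and these
  intervals are disjoint because a basis determines its topology.
\<close>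

lemma inj_opens: "inj opens"
  by (rule injI) (simp add: opens_def topology_eq set_eq_iff)

lemma opens_subset_Pow: "opens T \<subseteq> Pow (topspace T)"
  by (auto simp: opens_def dest: openin_subset)

lemma finite_opens: "finite (topspace T) \<Longrightarrow> finite (opens T)"
  by (rule finite_subset[OF opens_subset_Pow]) simp

text \<open>By \<open>inj_opens\<close>, a topology on \<open>S\<close> is the same as a point of
  the finite set \<open>Pow (Pow S)\<close>. This makes the sum in the theorem a genuine finite
  sum.\<close>

lemma finite_topologies_on:
  assumes "finite S"
  shows "finite (topologies_on S)"
proof (rule finite_imageD)
  have "opens ` topologies_on S \<subseteq> Pow (Pow S)"
    using opens_subset_Pow unfolding topologies_on_def by blast
  then show "finite (opens ` topologies_on S)"
    using assms by (simp add: finite_subset)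
  show "inj_on opens (topologies_on S)"
    by (rule inj_on_subset[OF inj_opens subset_UNIV])
qed

lemma mem_min_nbhd: "x \<in> min_nbhd T x"
  by (simp add: min_nbhd_def)

lemma min_nbhd_subset: "openin T U \<Longrightarrow> x \<in> U \<Longrightarrow> min_nbhd T x \<subseteq> U"
  by (auto simp: min_nbhd_def opens_def)

text \<open>Finiteness turns the defining intersection into a finite one; \<open>x\<close> being in
  the space makes \<open>topspace T\<close> one of the sets intersected, so the default
  \<open>\<Inter>{} = UNIV\<close> does not occur.\<close>

lemma openin_min_nbhd:
  assumes "finite (topspace T)" "x \<in> topspace T"
  shows "openin T (min_nbhd T x)"
  unfolding min_nbhd_def
proof (rule openin_Inter)
  show "{U \<in> opens T. x \<in> U} \<noteq> {}"
    using assms(2) openin_topspace[of T] unfolding opens_def by blast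
  show "finite {U \<in> opens T. x \<in> U}"
    by (rule finite_subset[OF _ finite_opens[OF assms(1)]]) blast
  show "openin T U" if "U \<in> {U \<in> opens T. x \<in> U}" for U
    using that by (simp add: opens_def)
qed

lemma min_nbhds_subset_opens: "finite (topspace T) \<Longrightarrow> min_nbhds T \<subseteq> opens T"
  by (auto simp: min_nbhds_def opens_def openin_min_nbhd)

text \<open>For open \<open>U\<close> the witness is \<open>V = min_nbhd T x\<close>. The right-hand
  side mentions only \<open>\<B>\<close>, so this also shows that \<open>\<B>\<close> determines
  \<open>T\<close>.\<close>

lemma openin_iff_between:
  assumes "min_nbhds T \<subseteq> \<B>" "\<B> \<subseteq> opens T"
  shows "openin T U \<longleftrightarrow> (\<forall>x\<in>U. \<exists>V\<in>\<B>. x \<in> V \<and> V \<subseteq> U)"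
proof
  assume U: "openin T U"
  show "\<forall>x\<in>U. \<exists>V\<in>\<B>. x \<in> V \<and> V \<subseteq> U"
  proof
    fix x assume x: "x \<in> U"
    then have "min_nbhd T x \<in> \<B>"
      using openin_subset[OF U] assms(1) by (auto simp: min_nbhds_def)
    then show "\<exists>V\<in>\<B>. x \<in> V \<and> V \<subseteq> U"
      using mem_min_nbhd[of x T] min_nbhd_subset[OF U x] by (intro bexI conjI)
  qed
next
  assume U: "\<forall>x\<in>U. \<exists>V\<in>\<B>. x \<in> V \<and> V \<subseteq> U"
  have "openin T V" if "V \<in> \<B>" for V
    using that assms(2) by (auto simp: opens_def)
  with U show "openin T U"
    by (meson openin_subopen)
qed

lemma topological_basis_on_between:
  assumes "min_nbhds T \<subseteq> \<B>" "\<B> \<subseteq> opens T"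
  shows "topological_basis_on (topspace T) \<B>"
  unfolding topological_basis_on_def
proof (intro conjI ballI)
  show sub: "\<B> \<subseteq> Pow (topspace T)"
    using assms(2) opens_subset_Pow by blast
  show "\<Union>\<B> = topspace T"
  proof
    show "topspace T \<subseteq> \<Union>\<B>"
      using iffD1[OF openin_iff_between[OF assms] openin_topspace] by blast
  qed (use sub in blast)
  fix B1 B2 x assume "B1 \<in> \<B>" "B2 \<in> \<B>" and x: "x \<in> B1 \<inter> B2"
  then have "openin T (B1 \<inter> B2)"
    using assms(2) by (auto simp: opens_def)
  then show "\<exists>B3\<in>\<B>. x \<in> B3 \<and> B3 \<subseteq> B1 \<inter> B2"
    by (rule bspec[OF iffD1[OF openin_iff_between[OF assms]] x])
qed

text \<open>The open sets are the unions of members of \<open>\<B>\<close>, described pointwise. The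
  refinement condition on \<open>\<B>\<close> is exactly what closes them under binary
  intersection.\<close>

lemma topological_basis_on_generates:
  assumes "topological_basis_on S \<B>"
  obtains T where "topspace T = S"
    and "\<And>U. openin T U \<longleftrightarrow> (\<forall>x\<in>U. \<exists>V\<in>\<B>. x \<in> V \<and> V \<subseteq> U)"
proof -
  let ?P = "\<lambda>U. \<forall>x\<in>U. \<exists>V\<in>\<B>. x \<in> V \<and> V \<subseteq> U"
  have "istopology ?P"
    unfolding istopology_def
  proof (intro conjI allI impI)
    fix U W assume UW: "?P U" "?P W"
    show "?P (U \<inter> W)"
    proof
      fix x assume "x \<in> U \<inter> W"
      then obtain B1 B2 where B: "B1 \<in> \<B>" "B1 \<subseteq> U" "B2 \<in> \<B>" "B2 \<subseteq> W" "x \<in> B1 \<inter> B2"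
        using UW by (meson IntD1 IntD2 IntI)
      then obtain B3 where "B3 \<in> \<B>" "x \<in> B3" "B3 \<subseteq> B1 \<inter> B2"
        using assms unfolding topological_basis_on_def by blast
      then show "\<exists>V\<in>\<B>. x \<in> V \<and> V \<subseteq> U \<inter> W"
        using B by blast
    qed
  next
    fix \<K> assume "\<forall>K\<in>\<K>. ?P K"
    then show "?P (\<Union>\<K>)"
      by (meson UnionE Union_upper subset_trans)
  qed
  then have op: "openin (topology ?P) U \<longleftrightarrow> ?P U" for U
    by (simp add: topology_inverse')
  have \<B>: "\<Union>\<B> = S"
    using assms by (simp add: topological_basis_on_def)
  \<comment> \<open>\<open>istopology\<close> prescribes no carrier, so it is computed: the whole
    space is open, hence covered by \<open>\<B>\<close>, and \<open>S = \<Union>\<B>\<close> itself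
    satisfies \<open>?P\<close>.\<close>
  have "topspace (topology ?P) = S"
  proof
    show "topspace (topology ?P) \<subseteq> S"
      using openin_topspace[of "topology ?P"] \<B> unfolding op by blast
    show "S \<subseteq> topspace (topology ?P)"
      using \<B> by (intro openin_subset) (auto simp: op)
  qed
  with op show thesis
    by (rule that[rotated])
qed

lemma topological_basis_on_imp_between:
  assumes "finite S" "topological_basis_on S \<B>"
  obtains T where "topspace T = S" "min_nbhds T \<subseteq> \<B>" "\<B> \<subseteq> opens T"
proof -
  obtain T where T: "topspace T = S"
    and op: "\<And>U. openin T U \<longleftrightarrow> (\<forall>x\<in>U. \<exists>V\<in>\<B>. x \<in> V \<and> V \<subseteq> U)"
    by (rule topological_basis_on_generates[OF assms(2)]) blast
  have sub: "\<B> \<subseteq> opens T"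
    by (auto simp: opens_def op)
  have "min_nbhd T x \<in> \<B>" if "x \<in> topspace T" for x
  proof -
    have "openin T (min_nbhd T x)"
      using that T assms(1) by (simp add: openin_min_nbhd)
    \<comment> \<open>Some basis member fits between \<open>x\<close> and its least open
      neighborhood; being open, it must equal that neighborhood.\<close>
    then obtain V where V: "V \<in> \<B>" "x \<in> V" "V \<subseteq> min_nbhd T x"
      using mem_min_nbhd[of x T] by (auto simp: op)
    then have "min_nbhd T x \<subseteq> V"
      using sub by (intro min_nbhd_subset) (auto simp: opens_def)
    with V show ?thesis by (simp add: subset_antisym)
  qed
  then have "min_nbhds T \<subseteq> \<B>"
    by (auto simp: min_nbhds_def)
  with T show thesis
    using sub by (rule that)
qed

text \<open>A member of the interval is \<open>A\<close> together with an arbitrary subset of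
  \<open>B - A\<close>. Since \<open>A \<subseteq> B\<close>, the subtraction of cardinalities is
  not truncated.\<close>

lemma card_interval_sets:
  assumes "finite B" "A \<subseteq> B"
  shows "card {X. A \<subseteq> X \<and> X \<subseteq> B} = 2 ^ (card B - card A)"
proof -
  have "bij_betw (\<lambda>Y. A \<union> Y) (Pow (B - A)) {X. A \<subseteq> X \<and> X \<subseteq> B}"
    by (rule bij_betw_byWitness[where f' = "\<lambda>X. X - A"]) (use assms(2) in auto)
  then have "card {X. A \<subseteq> X \<and> X \<subseteq> B} = card (Pow (B - A))"
    by (simp add: bij_betw_same_card)
  also have "\<dots> = 2 ^ (card B - card A)"
    using assms by (simp add: card_Pow card_Diff_subset finite_subset)
  finally show ?thesis .
qed

theorem mainTheorem1:
  fixes S :: "'a set"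
  assumes "finite S"
  shows "card {\<B>. \<B> \<subseteq> Pow S \<and> topological_basis_on S \<B>} =
    (\<Sum>T\<in>topologies_on S. 2 ^ (card (opens T) - card (min_nbhds T)))"
proof -
  let ?I = "\<lambda>T. {\<B>. min_nbhds T \<subseteq> \<B> \<and> \<B> \<subseteq> opens T}"
  have top: "topspace T = S" if "T \<in> topologies_on S" for T
    using that by (simp add: topologies_on_def)
  have "{\<B>. \<B> \<subseteq> Pow S \<and> topological_basis_on S \<B>} = (\<Union>T\<in>topologies_on S. ?I T)"
  proof (intro equalityI subsetI)
    fix \<B> assume "\<B> \<in> {\<B>. \<B> \<subseteq> Pow S \<and> topological_basis_on S \<B>}"
    then obtain T where "topspace T = S" "min_nbhds T \<subseteq> \<B>" "\<B> \<subseteq> opens T"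
      using topological_basis_on_imp_between[OF assms] by blast
    then show "\<B> \<in> (\<Union>T\<in>topologies_on S. ?I T)"
      by (auto simp: topologies_on_def)
  next
    fix \<B> assume "\<B> \<in> (\<Union>T\<in>topologies_on S. ?I T)"
    then have "topological_basis_on S \<B>"
      using topological_basis_on_between top by blast
    then show "\<B> \<in> {\<B>. \<B> \<subseteq> Pow S \<and> topological_basis_on S \<B>}"
      by (simp add: topological_basis_on_def)
  qed
  also have "card \<dots> = (\<Sum>T\<in>topologies_on S. card (?I T))"
  proof (rule card_UN_disjoint)
    show "finite (topologies_on S)"
      using assms by (rule finite_topologies_on)
    show "\<forall>T\<in>topologies_on S. finite (?I T)"
    proof
      fix T assume "T \<in> topologies_on S"
      then have "finite (Pow (opens T))"
        using assms top finite_opens by auto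
      then show "finite (?I T)"
        by (rule rev_finite_subset) auto
    qed
    \<comment> \<open>Both topologies have the open sets that \<open>openin_iff_between\<close>
      reads off from the common \<open>\<B>\<close>.\<close>
    have "T = T'" if "\<B> \<in> ?I T" "\<B> \<in> ?I T'" for \<B> and T T' :: "'a topology"
      using that openin_iff_between[of T \<B>] openin_iff_between[of T' \<B>]
      by (simp add: topology_eq)
    then show "\<forall>T\<in>topologies_on S. \<forall>T'\<in>topologies_on S. T \<noteq> T' \<longrightarrow> ?I T \<inter> ?I T' = {}"
      by blast
  qed
  also have "\<dots> = (\<Sum>T\<in>topologies_on S. 2 ^ (card (opens T) - card (min_nbhds T)))"
    using assms top
    by (intro sum.cong refl card_interval_sets finite_opens min_nbhds_subset_opens) auto
  finally show ?thesis .
qed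

end
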